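(* Let $W$ be a radial weight and put $\rho=\sqrt{m_1/m_0}$. Let $f,g\in F^2_W$ satisfy $|f(z)|\le|g(z)|$ for all $|z|>\rho$ and $|f(z)|=|g(z)|$ for all $|z|=\rho$. Then $\|f\|_W\le\|g\|_W$.
   Context: A radial weight is a measurable function $W\ge0$ on $[0,\infty)$, not almost everywhere zero, whose moments $m_k=\int_0^\infty t^kW(t)\,dt$, $k=0,1,2,\dots$, are all finite. $F^2_W$ is the space of entire functions $f$ with $\|f\|_W^2=\frac1\pi\int_{\mathbb C}|f(z)|^2W(|z|^2)\,dA(z)<\infty$, where $dA$ is area measure on $\mathbb C$. *)

theory Defs
  imports "HOL-Complex_Analysis.Complex_Analysis"
begin

definition radial_moment :: "(real \<Rightarrow> real) \<Rightarrow> nat \<Rightarrow> real" where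
  "radial_moment W k = (LINT t|lebesgue_on {0..}. t ^ k * W t)"

(* A weight is only constrained on the half-line; its values at negative arguments play no role. *)
definition radial_weight :: "(real \<Rightarrow> real) \<Rightarrow> bool" where
  "radial_weight W \<longleftrightarrow>
     W \<in> borel_measurable (lebesgue_on {0..}) \<and>
     (\<forall>t\<ge>0. 0 \<le> W t) \<and>
     \<not> (AE t in lebesgue_on {0..}. W t = 0) \<and>
     (\<forall>k::nat. integrable (lebesgue_on {0..}) (\<lambda>t. t ^ k * W t))"

(* The integrand is nonnegative and Lebesgue measurable, so integrability says exactly that
   its integral is finite. *)
definition weighted_Fock_space :: "(real \<Rightarrow> real) \<Rightarrow> (complex \<Rightarrow> complex) set" where
  "weighted_Fock_space W =
     {f. f holomorphic_on UNIV \<and>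
         integrable lebesgue (\<lambda>z::complex. (cmod (f z))\<^sup>2 * W ((cmod z)\<^sup>2))}"

definition weighted_Fock_norm :: "(real \<Rightarrow> real) \<Rightarrow> (complex \<Rightarrow> complex) \<Rightarrow> real" where
  "weighted_Fock_norm W f =
     sqrt (1 / pi * (LINT z|lebesgue. (cmod (f z))\<^sup>2 * W ((cmod z)\<^sup>2)))"

end

theory Submission
  imports Defs
begin

text \<open>Schwarz reflection in the circle of radius \<open>\<rho>\<close> turns the hypotheses into
  \<open>\<bar>g\<bar> \<le> \<bar>f\<bar>\<close> inside the disc, so \<open>g = q f\<close> there with \<open>\<bar>q\<bar> \<le> 1\<close>. Comparing mean squares of
  Taylor polynomials gives, with \<open>a\<close>, \<open>b\<close> the Taylor coefficients of \<open>f\<close>, \<open>g\<close> and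
  \<open>d\<^sub>k = (\<bar>b\<^sub>k\<bar>\<^sup>2 - \<bar>a\<^sub>k\<bar>\<^sup>2) \<rho>\<^bsup>2k\<^esup>\<close>, that all partial sums of \<open>d\<close> are nonpositive, while \<open>\<Sum>d\<^sub>k = 0\<close>.
  By summation by parts the circular mean \<open>\<Sum>d\<^sub>k t\<^sup>k\<close> of \<open>\<bar>g\<bar>\<^sup>2 - \<bar>f\<bar>\<^sup>2\<close> at \<open>t = \<bar>z\<bar>\<^sup>2 / \<rho>\<^sup>2\<close>
  lies above its tangent at \<open>t = 1\<close>, and \<open>\<rho>\<^sup>2 = m\<^sub>1 / m\<^sub>0\<close> says exactly that the tangent
  integrates to zero against the weight.\<close>

section \<open>Series with nonpositive partial sums\<close>

text \<open>The step from \<open>n\<close> to \<open>n + 1\<close> adds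
  \<open>(t - 1) * (t ^ n - 1)\<close>, a product of factors of the same sign, so the excess of
  \<open>t ^ n\<close> over its tangent at 1 grows with \<open>n\<close>. It starts at 0 for
  \<open>n = 0\<close>.\<close>

lemma tangent_excess:
  fixes t :: real
  assumes "t \<ge> 0"
  shows tangent_excess_nonneg: "0 \<le> t ^ n - 1 - real n * (t - 1)"
    and tangent_excess_Suc:
      "t ^ n - 1 - real n * (t - 1) \<le> t ^ Suc n - 1 - real (Suc n) * (t - 1)"
proof -
  have S: "t ^ n - 1 - real n * (t - 1) \<le> t ^ Suc n - 1 - real (Suc n) * (t - 1)" for n
  proof -
    have "0 \<le> (t - 1) * (t ^ n - 1)"
      using assms by (cases "t \<ge> 1") (auto simp: mult_nonpos_nonpos power_le_one)
    thus ?thesis by (simp add: algebra_simps)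
  qed
  show "t ^ n - 1 - real n * (t - 1) \<le> t ^ Suc n - 1 - real (Suc n) * (t - 1)" by (rule S)
  show "0 \<le> t ^ n - 1 - real n * (t - 1)"
  proof (induction n)
    case (Suc n)
    with S[of n] show ?case by linarith
  qed simp
qed

text \<open>Finite form of the summation by parts. Replacing \<open>e N\<close> by the larger
  \<open>e (Suc N)\<close> only lowers its product with a nonpositive partial sum, and the new term
  occurs on both sides.\<close>

lemma weighted_sum_ge_partial_sum:
  fixes d e :: "nat \<Rightarrow> real"
  assumes "\<And>n. (\<Sum>k\<le>n. d k) \<le> 0" "\<And>n. e n \<le> e (Suc n)"
  shows "(\<Sum>k\<le>N. d k) * e N \<le> (\<Sum>k\<le>N. d k * e k)"
proof (induction N)
  case (Suc N)
  have "(\<Sum>k\<le>N. d k) * e (Suc N) \<le> (\<Sum>k\<le>N. d k) * e N"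
    using assms by (intro mult_left_mono_neg) auto
  with Suc show ?case by (simp add: algebra_simps)
qed simp

text \<open>Summation by parts: the partial sums of \<open>d\<close> are nonpositive, so a zero-sum series tilts
  towards the larger values of the monotone weight \<open>e\<close>.\<close>

lemma suminf_weighted_nonneg:
  fixes d e :: "nat \<Rightarrow> real"
  assumes d: "\<And>n. (\<Sum>k\<le>n. d k) \<le> 0" and e: "\<And>n. e n \<le> e (Suc n)" "\<And>n. 0 \<le> e n"
    and sums: "d sums 0" and summ: "summable (\<lambda>k. \<bar>d k\<bar> * e k)"
  shows "0 \<le> (\<Sum>k. d k * e k)"
proof -
  define T where "T N = (\<Sum>k\<le>N. \<bar>d k\<bar> * e k)" for N
  have mono: "e m \<le> e n" if "m \<le> n" for m n using lift_Suc_mono_le[of e] e that by blast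
  have Tlim: "T \<longlonglongrightarrow> (\<Sum>k. \<bar>d k\<bar> * e k)"
    unfolding T_def using summable_LIMSEQ'[OF summ] by simp
  have slim: "(\<lambda>N. \<Sum>k\<le>N. d k) \<longlonglongrightarrow> 0" using sums by (simp add: sums_def_le)
  \<comment> \<open>The boundary term of the summation by parts is dominated by a tail of the
    convergent series of \<open>\<bar>d k\<bar> * e k\<close>: the total being zero, a partial sum
    is minus its own tail, and \<open>e N\<close> is at most every later \<open>e k\<close>.\<close>
  have bound: "\<bar>\<Sum>k\<le>N. d k\<bar> * e N \<le> (\<Sum>k. \<bar>d k\<bar> * e k) - T N" for N
  proof -
    have *: "\<bar>\<Sum>k\<le>N. d k\<bar> * e N \<le> \<bar>\<Sum>k\<le>M. d k\<bar> * e N + (T M - T N)" if "N \<le> M" for M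
    proof -
      have split: "(\<Sum>k\<le>M. x k) = (\<Sum>k\<le>N. x k) + (\<Sum>k\<in>{N<..M}. x k)" for x :: "nat \<Rightarrow> real"
      proof -
        have "{..M} = {..N} \<union> {N<..M}" using that by auto
        moreover have "{..N} \<inter> {N<..M} = {}" by auto
        ultimately show ?thesis by (simp add: sum.union_disjoint)
      qed
      have "\<bar>\<Sum>k\<in>{N<..M}. d k\<bar> * e N \<le> (\<Sum>k\<in>{N<..M}. \<bar>d k\<bar>) * e N"
        using e by (intro mult_right_mono sum_abs) auto
      also have "\<dots> \<le> (\<Sum>k\<in>{N<..M}. \<bar>d k\<bar> * e k)"
        unfolding sum_distrib_right by (intro sum_mono mult_left_mono mono) auto
      finally have 1: "\<bar>\<Sum>k\<in>{N<..M}. d k\<bar> * e N \<le> T M - T N" by (simp add: T_def split)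
      have "\<bar>\<Sum>k\<le>N. d k\<bar> \<le> \<bar>\<Sum>k\<le>M. d k\<bar> + \<bar>\<Sum>k\<in>{N<..M}. d k\<bar>" using split[of d] by linarith
      hence "\<bar>\<Sum>k\<le>N. d k\<bar> * e N \<le> (\<bar>\<Sum>k\<le>M. d k\<bar> + \<bar>\<Sum>k\<in>{N<..M}. d k\<bar>) * e N"
        using e by (intro mult_right_mono) auto
      with 1 show ?thesis by (simp add: algebra_simps)
    qed
    \<comment> \<open>Letting \<open>M\<close> tend to infinity kills the partial sum up to
      \<open>M\<close> and turns \<open>T M\<close> into the full series.\<close>
    have "(\<lambda>M. \<bar>\<Sum>k\<le>M. d k\<bar> * e N + (T M - T N)) \<longlonglongrightarrow> \<bar>0\<bar> * e N + ((\<Sum>k. \<bar>d k\<bar> * e k) - T N)"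
      by (intro tendsto_intros slim Tlim)
    from LIMSEQ_le_const[OF this, of "\<bar>\<Sum>k\<le>N. d k\<bar> * e N"] * show ?thesis by auto
  qed
  have "(\<lambda>N. T N - (\<Sum>k. \<bar>d k\<bar> * e k)) \<longlonglongrightarrow> 0" using Tlim by (simp add: LIM_zero)
  moreover have "summable (\<lambda>k. d k * e k)"
    by (rule summable_rabs_cancel) (use summ e in \<open>simp add: abs_mult\<close>)
  hence "(\<lambda>N. \<Sum>k\<le>N. d k * e k) \<longlonglongrightarrow> (\<Sum>k. d k * e k)" by (rule summable_LIMSEQ')
  moreover have "T N - (\<Sum>k. \<bar>d k\<bar> * e k) \<le> (\<Sum>k\<le>N. d k * e k)" for N
  proof -
    have "- (\<bar>\<Sum>k\<le>N. d k\<bar> * e N) = (\<Sum>k\<le>N. d k) * e N" using d[of N] by simp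
    with bound[of N] weighted_sum_ge_partial_sum[of d e N, OF d e(1)] show ?thesis by linarith
  qed
  ultimately show ?thesis by (intro LIMSEQ_le[of _ 0]) auto
qed

text \<open>The summation by parts is applied with the tangent excess of \<open>t ^ k\<close> as the
  monotone weight.\<close>

lemma suminf_power_ge_tangent:
  fixes d :: "nat \<Rightarrow> real" and t :: real
  assumes d: "\<And>n. (\<Sum>k\<le>n. d k) \<le> 0" and sums: "d sums 0"
    and summ: "\<And>R. R \<ge> 0 \<Longrightarrow> summable (\<lambda>k. \<bar>d k\<bar> * R ^ k)" and t: "t \<ge> 0"
  shows "(\<Sum>k. real k * d k) * (t - 1) \<le> (\<Sum>k. d k * t ^ k)"
proof -
  define e where "e k = t ^ k - 1 - real k * (t - 1)" for k
  \<comment> \<open>The summability hypothesis at radius 2 absorbs the factor \<open>k\<close>,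
    because \<open>k < 2 ^ k\<close>.\<close>
  have s1: "summable (\<lambda>k. real k * \<bar>d k\<bar>)"
  proof (rule summable_comparison_test'[OF summ[of 2], of 0])
    show "norm (real k * \<bar>d k\<bar>) \<le> \<bar>d k\<bar> * 2 ^ k" for k
      using mult_right_mono[OF of_nat_less_two_power[THEN less_imp_le], of "\<bar>d k\<bar>" k]
      by (simp add: mult.commute)
  qed auto
  have s1': "summable (\<lambda>k. real k * d k)"
    by (rule summable_rabs_cancel) (use s1 in \<open>simp add: abs_mult\<close>)
  have s2: "summable (\<lambda>k. d k * t ^ k)"
    by (rule summable_rabs_cancel) (use summ[OF t] t in \<open>simp add: abs_mult\<close>)
  have "summable (\<lambda>k. \<bar>d k\<bar> * t ^ k - \<bar>d k\<bar> * 1 ^ k - real k * \<bar>d k\<bar> * (t - 1))"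
    using t by (intro summable_diff summable_mult2 s1 summ) auto
  hence "summable (\<lambda>k. \<bar>d k\<bar> * e k)" by (simp add: e_def algebra_simps)
  hence "0 \<le> (\<Sum>k. d k * e k)"
    using tangent_excess[OF t] d sums by (intro suminf_weighted_nonneg) (auto simp: e_def)
  \<comment> \<open>The constant part of the tangent contributes nothing, since \<open>d\<close>
    sums to 0; only the slope term remains.\<close>
  also have "(\<lambda>k. d k * t ^ k - d k - real k * d k * (t - 1)) sums
      ((\<Sum>k. d k * t ^ k) - 0 - (\<Sum>k. real k * d k) * (t - 1))"
    by (intro sums_diff sums_mult2 summable_sums s1' s2 sums)
  hence "(\<Sum>k. d k * e k) = (\<Sum>k. d k * t ^ k) - (\<Sum>k. real k * d k) * (t - 1)"
    by (auto simp: e_def algebra_simps sums_iff)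
  finally show ?thesis by simp
qed

section \<open>Mean squares on circles\<close>

abbreviation angle_measure :: "real measure" where
  "angle_measure \<equiv> restrict_space lborel {0..2*pi}"

lemma finite_measure_angle: "finite_measure angle_measure"
  by (rule finite_measureI) (simp add: emeasure_restrict_space space_restrict_space)

text \<open>Orthogonality of the characters: off the diagonal the integrand is
  \<open>cis (k * \<theta>)\<close> with a nonzero integer \<open>k\<close>, whose antiderivative
  takes equal values at 0 and \<open>2 * pi\<close>.\<close>

lemma integral_cis_power_mult_cnj:
  "(LINT \<theta>|angle_measure. cis \<theta> ^ n * cnj (cis \<theta> ^ m)) = (if n = m then 2 * pi else 0)"
proof (cases "n = m")
  case True
  have "cis \<theta> ^ m * cnj (cis \<theta> ^ m) = 1" for \<theta>
    by (metis complex_norm_square norm_cis norm_power of_real_1 power_one)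
  with True show ?thesis
    by (simp add: measure_restrict_space space_restrict_space scaleR_conv_of_real)
next
  case False
  define k where "k = real n - real m"
  have k: "k \<noteq> 0" using False by (simp add: k_def)
  have eq: "cis \<theta> ^ n * cnj (cis \<theta> ^ m) = cis (k * \<theta>)" for \<theta>
    by (simp add: Complex.DeMoivre cis_cnj cis_mult k_def algebra_simps)
  have "has_bochner_integral lborel (\<lambda>\<theta>. indicator {0..2*pi} \<theta> *\<^sub>R cis (k * \<theta>))
      (cis (k * (2*pi)) / (\<i> * k) - cis (k * 0) / (\<i> * k))"
  proof (rule has_bochner_integral_FTC_Icc)
    show "((\<lambda>\<theta>. cis (k * \<theta>) / (\<i> * k)) has_vector_derivative cis (k * \<theta>)) (at \<theta> within {0..2*pi})" for \<theta>
    proof -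
      have "((\<lambda>z. exp (\<i> * k * z) / (\<i> * k)) has_field_derivative exp (\<i> * k * \<theta>)) (at (of_real \<theta>))"
        using k by (auto intro!: derivative_eq_intros)
      from has_vector_derivative_real_field[OF this] show ?thesis
        by (simp add: cis_conv_exp mult.assoc)
    qed
  qed (auto intro!: continuous_intros)
  moreover have "cis (k * (2*pi)) = 1"
  proof -
    have "k \<in> \<int>" by (simp add: k_def)
    thus ?thesis using cis_multiple_2pi[of k] by (simp add: mult_ac)
  qed
  ultimately show ?thesis using False
    by (simp add: eq integral_restrict_space set_lebesgue_integral_def has_bochner_integral_iff
        del: complex_cnj_power)
qed

text \<open>Expanding the squared modulus into a double sum leaves, by orthogonality, only the
  diagonal.\<close>

lemma circle_parseval_sum:
  fixes a :: "nat \<Rightarrow> complex"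
  shows "(LINT \<theta>|angle_measure. (cmod (\<Sum>n<N. a n * (r * cis \<theta>) ^ n))\<^sup>2)
       = 2 * pi * (\<Sum>n<N. (cmod (a n))\<^sup>2 * r ^ (2 * n))"
proof -
  interpret finite_measure angle_measure by (rule finite_measure_angle)
  have int: "integrable angle_measure (\<lambda>\<theta>. cis \<theta> ^ n * cnj (cis \<theta> ^ m))" for n m
  proof (rule integrable_const_bound[where B = 1])
    show "(\<lambda>\<theta>. cis \<theta> ^ n * cnj (cis \<theta> ^ m)) \<in> borel_measurable angle_measure"
      by (intro measurable_restrict_space1)
         (simp, intro borel_measurable_continuous_onI continuous_intros)
  qed (auto simp: norm_mult norm_power)
  define b where "b n = a n * of_real r ^ n" for n
  have sq: "complex_of_real ((cmod (\<Sum>n<N. a n * (r * cis \<theta>) ^ n))\<^sup>2)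
      = (\<Sum>n<N. \<Sum>m<N. b n * cnj (b m) * (cis \<theta> ^ n * cnj (cis \<theta> ^ m)))" for \<theta>
    by (simp add: complex_norm_square b_def cnj_sum sum_product power_mult_distrib mult_ac
             del: of_real_power)
  have "complex_of_real (LINT \<theta>|angle_measure. (cmod (\<Sum>n<N. a n * (r * cis \<theta>) ^ n))\<^sup>2)
      = (LINT \<theta>|angle_measure. complex_of_real ((cmod (\<Sum>n<N. a n * (r * cis \<theta>) ^ n))\<^sup>2))"
    by (rule integral_complex_of_real [symmetric])
  also have "\<dots> = (\<Sum>n<N. \<Sum>m<N. b n * cnj (b m) * (if n = m then 2 * pi else 0))"
    unfolding sq by (simp add: int integral_cis_power_mult_cnj del: complex_cnj_power)
  also have "\<dots> = (\<Sum>n<N. b n * cnj (b n) * (2 * pi))"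
    by (intro sum.cong refl)
       (simp add: if_distrib[of complex_of_real] if_distrib[of "\<lambda>x. _ * x"] cong: if_cong)
  also have "\<dots> = complex_of_real (2 * pi * (\<Sum>n<N. (cmod (a n))\<^sup>2 * r ^ (2 * n)))"
  proof -
    have "b n * cnj (b n) = complex_of_real ((cmod (a n))\<^sup>2 * r ^ (2 * n))" for n
      unfolding complex_norm_square[symmetric]
      by (simp add: b_def norm_mult norm_power power_mult_distrib power_mult[symmetric] mult.commute
          flip: of_real_power)
    thus ?thesis by (simp add: sum_distrib_left mult_ac)
  qed
  finally show ?thesis using of_real_eq_iff by blast
qed

text \<open>Dominated convergence carries the finite identity to the limit: on the circle all
  partial sums are bounded by \<open>C\<close>, the sum of
  \<open>cmod (a n) * r ^ n\<close>.\<close>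

lemma circle_parseval:
  fixes a :: "nat \<Rightarrow> complex"
  assumes r: "r \<ge> 0" and summ: "summable (\<lambda>n. cmod (a n) * r ^ n)"
    and F: "\<And>z. cmod z = r \<Longrightarrow> (\<lambda>n. a n * z ^ n) sums F z"
  shows "(\<lambda>n. (cmod (a n))\<^sup>2 * r ^ (2 * n)) sums
           ((LINT \<theta>|angle_measure. (cmod (F (r * cis \<theta>)))\<^sup>2) / (2 * pi))"
proof -
  interpret finite_measure angle_measure by (rule finite_measure_angle)
  define C where "C = (\<Sum>n. cmod (a n) * r ^ n)"
  define S where "S N \<theta> = (cmod (\<Sum>n<N. a n * (r * cis \<theta>) ^ n))\<^sup>2" for N \<theta>
  have lim: "(\<lambda>N. S N \<theta>) \<longlonglongrightarrow> (cmod (F (r * cis \<theta>)))\<^sup>2" for \<theta>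
    using F[of "r * cis \<theta>"] r unfolding S_def
    by (intro tendsto_intros) (auto simp: sums_def norm_mult)
  have meas: "S N \<in> borel_measurable angle_measure" for N
    unfolding S_def
    by (intro measurable_restrict_space1)
       (simp, intro borel_measurable_continuous_onI continuous_intros)
  have "norm (S N \<theta>) \<le> C\<^sup>2" for N \<theta>
  proof -
    have "cmod (\<Sum>n<N. a n * (r * cis \<theta>) ^ n) \<le> (\<Sum>n<N. cmod (a n) * r ^ n)"
      using r by (intro sum_norm_le) (auto simp: norm_mult norm_power)
    also have "\<dots> \<le> C" unfolding C_def using r by (intro sum_le_suminf summ) auto
    finally show ?thesis by (simp add: S_def power_mono)
  qed
  hence "(\<lambda>N. LINT \<theta>|angle_measure. S N \<theta>) \<longlonglongrightarrow> (LINT \<theta>|angle_measure. (cmod (F (r * cis \<theta>)))\<^sup>2)"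
    by (intro integral_dominated_convergence[where w = "\<lambda>_. C\<^sup>2"]
          borel_measurable_LIMSEQ_real[OF lim meas] meas)
       (use lim in auto)
  hence "(\<lambda>N. (LINT \<theta>|angle_measure. S N \<theta>) / (2 * pi)) \<longlonglongrightarrow>
      (LINT \<theta>|angle_measure. (cmod (F (r * cis \<theta>)))\<^sup>2) / (2 * pi)"
    by (intro tendsto_intros) auto
  thus ?thesis by (simp add: sums_def S_def circle_parseval_sum)
qed

section \<open>Domination inside the disc\<close>

text \<open>Two conjugations restore holomorphy. For positive real \<open>c\<close>,
  \<open>cnj (c / z)\<close> is the mirror image of \<open>z\<close> in the circle of radius
  \<open>sqrt c\<close>, so this is the Schwarz reflection of \<open>f\<close>.\<close>

lemma reflected_conjugate_holomorphic:
  assumes "f holomorphic_on UNIV"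
  shows "(\<lambda>z. cnj (f (cnj (c / z)))) holomorphic_on - {0}"
proof -
  have "(cnj \<circ> f \<circ> cnj) holomorphic_on UNIV"
    using assms by (intro holomorphic_on_compose_cnj_cnj) (auto intro: holomorphic_on_subset)
  hence "((cnj \<circ> f \<circ> cnj) \<circ> (\<lambda>z. c / z)) holomorphic_on - {0}"
  proof (rule holomorphic_on_compose_gen [rotated])
    show "(\<lambda>z. c / z) holomorphic_on - {0}" by (intro holomorphic_intros) auto
  qed auto
  thus ?thesis by (simp add: o_def)
qed

text \<open>Writing \<open>f\<^sup>*\<close> for the Schwarz reflection in the circle, the hypothesis on the circle says
  \<open>f f\<^sup>* = g g\<^sup>*\<close> there, hence on the punctured plane, and \<open>\<bar>f\<^sup>*\<bar> \<le> \<bar>g\<^sup>*\<bar>\<close> inside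
  forces \<open>\<bar>g\<bar> \<le> \<bar>f\<bar>\<close>.\<close>

lemma norm_le_inside_of_norm_le_outside:
  assumes f: "f holomorphic_on UNIV" and g: "g holomorphic_on UNIV" and \<rho>: "\<rho> > 0"
    and outside: "\<And>z. cmod z > \<rho> \<Longrightarrow> cmod (f z) \<le> cmod (g z)"
    and circle: "\<And>z. cmod z = \<rho> \<Longrightarrow> cmod (f z) = cmod (g z)"
    and nz: "f w0 \<noteq> 0" and z: "cmod z < \<rho>"
  shows "cmod (g z) \<le> cmod (f z)"
proof -
  define R where "R z = cnj (of_real (\<rho>\<^sup>2) / z)" for z
  have R: "cmod (R z) = \<rho>\<^sup>2 / cmod z" for z by (simp add: R_def norm_divide norm_power)
  have RR: "R (R z) = z" for z using \<rho> by (simp add: R_def)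
  define E where "E z = f z * cnj (f (R z)) - g z * cnj (g (R z))" for z
  have E: "E holomorphic_on - {0}"
    unfolding E_def R_def
    by (intro holomorphic_intros reflected_conjugate_holomorphic f g
          holomorphic_on_subset[OF f] holomorphic_on_subset[OF g]) auto
  \<comment> \<open>Identity theorem on the connected punctured plane: \<open>E\<close> vanishes on
    the circle, where \<open>R\<close> is the identity and the moduli agree.\<close>
  have E0: "E z = 0" if "z \<noteq> 0" for z
  proof (rule analytic_continuation[OF E _ _ _ _ _ _, of "sphere 0 \<rho>" "of_real \<rho>"])
    show "connected (- {0::complex})"
      by (intro connected_punctured_universe) auto
    show "complex_of_real \<rho> islimpt sphere 0 \<rho>"
    \<comment> \<open>A connected set with more than one point has no isolated point, so the circle
      accumulates at each of its points.\<close>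
    proof (rule connected_imp_perfect)
      have "of_real \<rho> \<in> sphere (0::complex) \<rho>" "- of_real \<rho> \<in> sphere (0::complex) \<rho>"
        "complex_of_real \<rho> \<noteq> - of_real \<rho>" using \<rho> by auto
      thus "sphere (0::complex) \<rho> \<noteq> {a}" for a by (metis singletonD)
    qed (use \<rho> in \<open>auto intro!: connected_sphere\<close>)
    show "E w = 0" if "w \<in> sphere 0 \<rho>" for w
    proof -
      have w: "cmod w = \<rho>" using that by simp
      have "R w = w"
      proof -
        have "w \<noteq> 0" using w \<rho> by auto
        moreover have "w * cnj w = of_real (\<rho>\<^sup>2)" using w complex_norm_square[of w] by simp
        ultimately show ?thesis by (simp add: R_def divide_simps mult.commute)
      qed
      thus ?thesis using circle[OF w]
        by (simp add: E_def complex_norm_square[symmetric])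
    qed
  qed (use \<rho> that in auto)
  \<comment> \<open>Generic points: \<open>R w\<close> lies outside the circle, where
    \<open>g\<close> dominates \<open>f\<close>, and \<open>E w = 0\<close> reverses the comparison
    at \<open>w\<close>. The cancellation needs \<open>f (R w) \<noteq> 0\<close>.\<close>
  have key: "cmod (g w) \<le> cmod (f w)" if w: "cmod w < \<rho>" "w \<noteq> 0" "f (R w) \<noteq> 0" for w
  proof -
    have "\<rho> < cmod (R w)" using w \<rho> by (simp add: R power2_eq_square field_simps)
    hence le: "cmod (f (R w)) \<le> cmod (g (R w))" by (rule outside)
    have "cmod (g w) * cmod (f (R w)) \<le> cmod (g w) * cmod (g (R w))"
      using le by (intro mult_left_mono) auto
    also have "\<dots> = cmod (f w) * cmod (f (R w))"
      using E0[OF w(2)] unfolding E_def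
      by (metis (no_types) complex_mod_cnj eq_iff_diff_eq_0 norm_mult)
    finally show ?thesis using w(3) by (simp add: mult_le_cancel_right)
  qed
  \<comment> \<open>By continuity the inequality at a point follows from the inequality near it.
    This recovers first the points whose mirror image is a zero of \<open>f\<close>, then the
    origin.\<close>
  have step: "cmod (g w) \<le> cmod (f w)"
    if ev: "\<forall>\<^sub>F v in at w. cmod (g v) \<le> cmod (f v)" for w
  proof (rule tendsto_le[OF _ _ _ ev])
    have "isCont f w" "isCont g w"
      using f g holomorphic_on_imp_continuous_on continuous_on_eq_continuous_at open_UNIV by blast+
    thus "((\<lambda>v. cmod (f v)) \<longlongrightarrow> cmod (f w)) (at w)" "((\<lambda>v. cmod (g v)) \<longlongrightarrow> cmod (g w)) (at w)"
      by (auto intro!: tendsto_intros simp: isCont_def)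
  qed simp
  have near: "\<forall>\<^sub>F v in at w. cmod v < \<rho>" if "cmod w < \<rho>" for w
    by (rule order_tendstoD(2)[OF _ that]) (auto intro!: tendsto_intros)
  have punctured: "cmod (g w) \<le> cmod (f w)" if w: "cmod w < \<rho>" "w \<noteq> 0" for w
  proof (rule step)
    \<comment> \<open>Zeros of \<open>f\<close> are isolated, and \<open>R\<close>, being its own
      inverse, sends points near but different from \<open>w\<close> to points near but different
      from \<open>R w\<close>.\<close>
    have "\<forall>\<^sub>F u in at (R w). f u \<noteq> 0"
      using non_zero_neighbour_alt[of f UNIV "R w" w0] f nz by (auto elim: eventually_mono)
    moreover have "filterlim R (at (R w)) (at w)"
      unfolding filterlim_at
    proof
      show "\<forall>\<^sub>F v in at w. R v \<in> UNIV \<and> R v \<noteq> R w"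
        unfolding eventually_at_filter by (rule always_eventually) (metis RR UNIV_I)
      show "(R \<longlongrightarrow> R w) (at w)" unfolding R_def using w by (auto intro!: tendsto_intros)
    qed
    ultimately have "\<forall>\<^sub>F v in at w. f (R v) \<noteq> 0" by (rule eventually_compose_filterlim)
    moreover have "\<forall>\<^sub>F v in at w. v \<noteq> 0"
      by (rule eventually_neq_at_within)
    ultimately show "\<forall>\<^sub>F v in at w. cmod (g v) \<le> cmod (f v)"
      using near[OF w(1)] by eventually_elim (rule key)
  qed
  have "\<forall>\<^sub>F v in at z. v \<noteq> 0"
    by (rule eventually_neq_at_within)
  with near[OF z] have "\<forall>\<^sub>F v in at z. cmod (g v) \<le> cmod (f v)"
    by eventually_elim (rule punctured)
  thus ?thesis by (rule step)
qed

text \<open>Zeros of \<open>f\<close> are isolated because \<open>f\<close> is not identically zero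
  on the connected set, and near them \<open>g / f\<close> is bounded by 1, so Riemann's theorem
  removes the singularities. The claims at such points follow by taking limits.\<close>

lemma holomorphic_quotient_of_norm_le:
  assumes f: "f holomorphic_on S" and g: "g holomorphic_on S" and S: "open S" "connected S"
    and nz: "w0 \<in> S" "f w0 \<noteq> 0"
    and le: "\<And>z. z \<in> S \<Longrightarrow> cmod (g z) \<le> cmod (f z)"
  obtains q where "q holomorphic_on S" "\<And>z. z \<in> S \<Longrightarrow> g z = q z * f z"
    "\<And>z. z \<in> S \<Longrightarrow> cmod (q z) \<le> 1"
proof -
  define Q where "Q z = g z / f z" for z
  define q where "q = remove_sings Q"
  have *: "q analytic_on {z} \<and> g z = q z * f z \<and> cmod (q z) \<le> 1" if z: "z \<in> S" for z
  proof -
    have ev: "\<forall>\<^sub>F w in at z. f w \<noteq> 0 \<and> w \<in> S"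
      by (rule non_zero_neighbour_alt[OF f S z nz])
    then obtain d where d: "d > 0" "\<And>w. w \<noteq> z \<Longrightarrow> dist w z < d \<Longrightarrow> f w \<noteq> 0 \<and> w \<in> S"
      unfolding eventually_at by auto
    have sub: "f w \<noteq> 0 \<and> w \<in> S" if "w \<in> ball z d - {z}" for w
      using d(2)[of w] that by (simp add: dist_commute)
    have hol: "Q holomorphic_on (ball z d - {z})"
      unfolding Q_def using sub
      by (intro holomorphic_intros holomorphic_on_subset[OF f] holomorphic_on_subset[OF g])
         blast+
    have iso: "isolated_singularity_at Q z"
      by (rule isolated_singularity_at_holomorphic[OF hol]) (use d in auto)
    have Qle: "cmod (Q w) \<le> 1" if "f w \<noteq> 0 \<and> w \<in> S" for w
      using le[of w] that by (simp add: Q_def norm_divide divide_simps)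
    \<comment> \<open>The extension \<open>u\<close> only serves to show that \<open>Q\<close> has a
      finite limit at \<open>z\<close>, which makes \<open>remove_sings Q\<close> analytic
      there.\<close>
    have "\<forall>\<^sub>F w in at z. cmod (Q w) \<le> 1" using ev by eventually_elim (rule Qle)
    then obtain u where u: "u holomorphic_on ball z d" "\<And>w. w \<in> ball z d - {z} \<Longrightarrow> u w = Q w"
      using holomorphic_on_extend_bounded[OF hol] d(1) by (metis interior_ball centre_in_ball)
    have "isCont u z"
      using u(1) d(1) holomorphic_on_imp_continuous_on continuous_on_eq_continuous_at
      by (metis centre_in_ball open_ball)
    moreover have "\<forall>\<^sub>F w in at z. u w = Q w"
      unfolding eventually_at using d(1) u(2) by (auto intro!: exI[of _ d] simp: dist_commute)
    ultimately have "Q \<midarrow>z\<rightarrow> u z" unfolding isCont_def by (blast intro: Lim_transform_eventually)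
    hence an: "q analytic_on {z}" unfolding q_def by (rule remove_sings_analytic_at[OF iso])
    hence qc: "q \<midarrow>z\<rightarrow> q z" by (simp add: analytic_at_imp_isCont isContD)
    have evq: "\<forall>\<^sub>F w in at z. q w = Q w"
      unfolding q_def by (rule eventually_remove_sings_eq_at[OF iso])
    have fc: "f \<midarrow>z\<rightarrow> f z" and gc: "g \<midarrow>z\<rightarrow> g z"
      using f g S z holomorphic_on_imp_continuous_on continuous_on_eq_continuous_at isContD by metis+
    have "\<forall>\<^sub>F w in at z. q w * f w = g w"
      using evq ev by eventually_elim (auto simp: Q_def)
    hence "g \<midarrow>z\<rightarrow> q z * f z"
      by (rule Lim_transform_eventually[OF tendsto_mult[OF qc fc]])
    hence "g z = q z * f z" using gc tendsto_unique by (metis at_neq_bot)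
    moreover have "cmod (q z) \<le> 1"
    proof (rule tendsto_upperbound[OF tendsto_norm[OF qc]])
      show "\<forall>\<^sub>F w in at z. cmod (q w) \<le> 1"
        using evq ev by eventually_elim (use Qle in auto)
    qed simp
    ultimately show ?thesis using an by blast
  qed
  show ?thesis
  proof (rule that[of q])
    show "q holomorphic_on S"
      by (rule analytic_imp_holomorphic, subst analytic_on_analytic_at) (use * in blast)
  qed (use * in auto)
qed

section \<open>Comparison of Taylor coefficients on a disc\<close>

lemma circle_parseval_holomorphic:
  assumes h: "h holomorphic_on ball 0 R" and r: "0 \<le> r" "r < R"
  shows "(\<lambda>n. (cmod ((deriv ^^ n) h 0 / fact n))\<^sup>2 * r ^ (2 * n)) sums
           ((LINT \<theta>|angle_measure. (cmod (h (r * cis \<theta>)))\<^sup>2) / (2 * pi))"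
proof (rule circle_parseval[OF r(1)])
  have ps: "(\<lambda>n. (deriv ^^ n) h 0 / fact n * z ^ n) sums h z" if "cmod z < R" for z
    using holomorphic_power_series[OF h, of z] that by simp
  show "(\<lambda>n. (deriv ^^ n) h 0 / fact n * z ^ n) sums h z" if "cmod z = r" for z
    using ps that r by simp
  \<comment> \<open>Convergence at the intermediate radius \<open>(r + R) / 2\<close> forces
    absolute convergence at \<open>r\<close>.\<close>
  have "summable (\<lambda>n. (deriv ^^ n) h 0 / fact n * of_real ((r + R) / 2) ^ n)"
    using ps[of "of_real ((r + R) / 2)"] r by (auto simp: sums_iff simp flip: of_real_add)
  hence "summable (\<lambda>n. cmod ((deriv ^^ n) h 0 / fact n * of_real r ^ n))"
    by (rule powser_insidea) (use r in \<open>simp flip: of_real_add\<close>)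
  thus "summable (\<lambda>n. cmod ((deriv ^^ n) h 0 / fact n) * r ^ n)"
    using r by (simp add: norm_mult norm_power norm_divide)
qed

text \<open>If \<open>g = q f\<close> with \<open>\<bar>q\<bar> \<le> 1\<close>, the first coefficients of \<open>g\<close> depend only on those of \<open>f\<close>:
  they agree with the coefficients of \<open>q p\<close>, where \<open>p\<close> is the Taylor polynomial of \<open>f\<close>, and
  multiplication by \<open>q\<close> does not increase the mean square of \<open>p\<close> on a circle.\<close>

lemma coeff_partial_sums_le:
  fixes f g :: "complex \<Rightarrow> complex"
  assumes f: "f holomorphic_on ball 0 R" and g: "g holomorphic_on ball 0 R" and R: "0 < R"
    and nz: "cmod w0 < R" "f w0 \<noteq> 0"
    and le: "\<And>z. cmod z < R \<Longrightarrow> cmod (g z) \<le> cmod (f z)"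
  defines "a \<equiv> \<lambda>n. (deriv ^^ n) f 0 / fact n" and "b \<equiv> \<lambda>n. (deriv ^^ n) g 0 / fact n"
  shows "(\<Sum>k\<le>n. (cmod (b k))\<^sup>2 * R ^ (2 * k)) \<le> (\<Sum>k\<le>n. (cmod (a k))\<^sup>2 * R ^ (2 * k))"
proof -
  obtain q where q: "q holomorphic_on ball 0 R" "\<And>z. z \<in> ball 0 R \<Longrightarrow> g z = q z * f z"
    "\<And>z. z \<in> ball 0 R \<Longrightarrow> cmod (q z) \<le> 1"
    by (rule holomorphic_quotient_of_norm_le[OF f g open_ball _, of w0]) (use nz le in auto)
  define p where "p z = (\<Sum>k\<le>n. a k * z ^ k)" for z
  define h where "h z = q z * p z" for z
  define c where "c k = (deriv ^^ k) h 0 / fact k" for k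
  have h: "h holomorphic_on ball 0 R"
    unfolding h_def p_def by (intro holomorphic_intros q)
  have R0: "0 \<in> ball (0::complex) R" using R by simp
  note expand = has_fps_expansion_fps_expansion[OF open_ball R0]
  define P where "P = (\<Sum>k\<le>n. fps_const (a k) * fps_X ^ k)"
  have P: "p has_fps_expansion P" unfolding p_def P_def by (intro fps_expansion_intros)
  have Pnth: "fps_nth P k = (if k \<le> n then a k else 0)" for k
    by (simp add: P_def fps_sum_nth fps_X_power_nth if_distrib[of "\<lambda>x. _ * x"] cong: if_cong)
  have "h has_fps_expansion fps_expansion q 0 * P"
    unfolding h_def by (intro fps_expansion_intros expand q P)
  hence c: "c k = fps_nth (fps_expansion q 0 * P) k" for k
    by (simp add: c_def fps_nth_fps_expansion)
  have "(\<lambda>z. q z * f z) has_fps_expansion fps_expansion q 0 * fps_expansion f 0"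
    by (intro fps_expansion_intros expand q f)
  moreover have "\<forall>\<^sub>F z in nhds 0. q z * f z = g z"
    using eventually_nhds_in_open[OF open_ball R0] by eventually_elim (use q in auto)
  ultimately have "g has_fps_expansion fps_expansion q 0 * fps_expansion f 0"
    using has_fps_expansion_cong[of "\<lambda>z. q z * f z" g] by simp
  hence b: "b k = fps_nth (fps_expansion q 0 * fps_expansion f 0) k" for k
    by (simp add: b_def fps_nth_fps_expansion)
  have fnth: "fps_nth (fps_expansion f 0) k = a k" for k by (simp add: a_def fps_expansion_def)
  \<comment> \<open>The coefficient of index \<open>k\<close> of a product involves only
    coefficients up to \<open>k\<close> of the factors, and up to \<open>n\<close> those of
    \<open>P\<close> are those of \<open>f\<close>.\<close>
  have bc: "b k = c k" if "k \<le> n" for k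
    using that unfolding b c fps_mult_nth by (intro sum.cong) (auto simp: Pnth fnth)
  have circle: "(\<Sum>k\<le>n. (cmod (b k))\<^sup>2 * r ^ (2 * k)) \<le> (\<Sum>k\<le>n. (cmod (a k))\<^sup>2 * r ^ (2 * k))"
    if r: "0 < r" "r < R" for r
  proof -
    have on: "r * cis \<theta> \<in> ball 0 R" for \<theta> using r by (simp add: norm_mult)
    have ps: "(\<lambda>k. (cmod (c k))\<^sup>2 * r ^ (2 * k)) sums
        ((LINT \<theta>|angle_measure. (cmod (h (r * cis \<theta>)))\<^sup>2) / (2 * pi))"
      unfolding c_def by (rule circle_parseval_holomorphic[OF h]) (use r in auto)
    have int: "integrable angle_measure (\<lambda>\<theta>. (cmod (u (r * cis \<theta>)))\<^sup>2)" if u: "u holomorphic_on ball 0 R" for u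
    proof -
      have "continuous_on {0..2*pi} (\<lambda>\<theta>. (cmod (u (r * cis \<theta>)))\<^sup>2)"
        by (intro continuous_intros continuous_on_compose2[OF holomorphic_on_imp_continuous_on[OF u]])
           (use on in auto)
      hence "set_integrable lborel {0..2*pi} (\<lambda>\<theta>. (cmod (u (r * cis \<theta>)))\<^sup>2)"
        by (rule borel_integrable_atLeastAtMost')
      thus ?thesis by (simp add: integrable_restrict_space set_integrable_def)
    qed
    have "(\<Sum>k\<le>n. (cmod (b k))\<^sup>2 * r ^ (2 * k)) = (\<Sum>k\<le>n. (cmod (c k))\<^sup>2 * r ^ (2 * k))"
      by (simp add: bc)
    \<comment> \<open>Passing to the full series adds nonnegative terms only; it brings in the mean
      square of \<open>h = q p\<close>, which the bound on \<open>q\<close> compares with that of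
      \<open>p\<close>.\<close>
    also have "\<dots> \<le> (\<Sum>k. (cmod (c k))\<^sup>2 * r ^ (2 * k))"
      using ps r by (intro sum_le_suminf) (auto simp: sums_iff)
    also have "\<dots> = (LINT \<theta>|angle_measure. (cmod (h (r * cis \<theta>)))\<^sup>2) / (2 * pi)"
      using ps by (simp add: sums_iff)
    also have "\<dots> \<le> (LINT \<theta>|angle_measure. (cmod (p (r * cis \<theta>)))\<^sup>2) / (2 * pi)"
    proof (intro divide_right_mono integral_mono int h)
      show "p holomorphic_on ball 0 R" unfolding p_def by (intro holomorphic_intros)
      show "(cmod (h (r * cis \<theta>)))\<^sup>2 \<le> (cmod (p (r * cis \<theta>)))\<^sup>2" for \<theta>
        using mult_right_mono[OF q(3)[OF on[of \<theta>]], of "cmod (p (r * cis \<theta>))"]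
        by (simp add: h_def norm_mult power_mono)
    qed simp
    also have "\<dots> = (\<Sum>k\<le>n. (cmod (a k))\<^sup>2 * r ^ (2 * k))"
      using circle_parseval_sum[where N = "Suc n" and a = a and r = r] by (simp add: p_def lessThan_Suc_atMost)
    finally show ?thesis .
  qed
  \<comment> \<open>The comparison is known only on circles strictly inside the disc; both sides are
    polynomials in \<open>r\<close>, so \<open>r\<close> may tend to \<open>R\<close>.\<close>
  have lim: "((\<lambda>r. \<Sum>k\<le>n. (cmod (x k))\<^sup>2 * r ^ (2 * k)) \<longlongrightarrow> (\<Sum>k\<le>n. (cmod (x k))\<^sup>2 * R ^ (2 * k))) (at_left R)"
    for x :: "nat \<Rightarrow> complex" by (intro tendsto_intros)
  show ?thesis
  proof (rule tendsto_le[OF _ lim lim])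
    show "\<forall>\<^sub>F r in at_left R. (\<Sum>k\<le>n. (cmod (b k))\<^sup>2 * r ^ (2 * k)) \<le> (\<Sum>k\<le>n. (cmod (a k))\<^sup>2 * r ^ (2 * k))"
      using eventually_at_left_real[OF R] by eventually_elim (rule circle, auto)
  qed simp
qed

section \<open>Radial integration in the plane\<close>

text \<open>A Borel measure giving each box its volume is Lebesgue measure, and under
  \<open>Complex\<close> boxes correspond to rectangles.\<close>

lemma lborel_complex_eq_distr_pair:
  "(lborel :: complex measure) = distr (lborel \<Otimes>\<^sub>M lborel) borel (\<lambda>(x, y). Complex x y)"
proof (rule lborel_eqI)
  have meas [measurable]: "(\<lambda>(x, y). Complex x y) \<in> borel_measurable (lborel \<Otimes>\<^sub>M lborel)"
    unfolding Complex_eq by measurable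
  fix l u :: complex
  assume le: "\<And>b. b \<in> Basis \<Longrightarrow> l \<bullet> b \<le> u \<bullet> b"
  have le: "Re l \<le> Re u" "Im l \<le> Im u" using le[of 1] le[of \<i>] by (auto simp: Basis_complex_def)
  have "(\<lambda>(x, y). Complex x y) -` box l u \<inter> space (lborel \<Otimes>\<^sub>M lborel)
      = {Re l<..<Re u} \<times> {Im l<..<Im u}"
    by (auto simp: in_box_complex_iff space_pair_measure)
  hence "emeasure (distr (lborel \<Otimes>\<^sub>M lborel) borel (\<lambda>(x, y). Complex x y)) (box l u)
      = emeasure (lborel \<Otimes>\<^sub>M lborel) ({Re l<..<Re u} \<times> {Im l<..<Im u})"
    by (simp add: emeasure_distr)
  also have "\<dots> = ennreal (Re u - Re l) * ennreal (Im u - Im l)"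
    using le by (subst lborel.emeasure_pair_measure_Times) auto
  also have "\<dots> = ennreal (\<Prod>b\<in>Basis. (u - l) \<bullet> b)"
    using le by (simp add: Basis_complex_def ennreal_mult)
  finally show "emeasure (distr (lborel \<Otimes>\<^sub>M lborel) borel (\<lambda>(x, y). Complex x y)) (box l u)
      = ennreal (\<Prod>b\<in>Basis. (u - l) \<bullet> b)" .
qed simp

lemma measurable_Complex [measurable (raw)]:
  assumes "f \<in> borel_measurable M" "g \<in> borel_measurable M"
  shows "(\<lambda>x. Complex (f x) (g x)) \<in> borel_measurable M"
  using assms unfolding Complex_eq by measurable

text \<open>Tonelli in both orders: each of the two shears needs the coordinate it translates as the
  inner variable.\<close>

lemma nn_integral_complex_iterated:
  assumes [measurable]: "F \<in> borel_measurable borel"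
  shows "(\<integral>\<^sup>+z. F z \<partial>lborel) = (\<integral>\<^sup>+x. \<integral>\<^sup>+y. F (Complex x y) \<partial>lborel \<partial>lborel)"
    and "(\<integral>\<^sup>+z. F z \<partial>lborel) = (\<integral>\<^sup>+y. \<integral>\<^sup>+x. F (Complex x y) \<partial>lborel \<partial>lborel)"
proof -
  have "(\<integral>\<^sup>+z. F z \<partial>lborel) = (\<integral>\<^sup>+p. F (Complex (fst p) (snd p)) \<partial>(lborel \<Otimes>\<^sub>M lborel))"
    by (subst lborel_complex_eq_distr_pair) (simp add: nn_integral_distr case_prod_beta)
  also have "\<dots> = (\<integral>\<^sup>+x. \<integral>\<^sup>+y. F (Complex x y) \<partial>lborel \<partial>lborel)"
    by (subst lborel.nn_integral_fst[symmetric]) auto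
  finally show 1: "(\<integral>\<^sup>+z. F z \<partial>lborel) = (\<integral>\<^sup>+x. \<integral>\<^sup>+y. F (Complex x y) \<partial>lborel \<partial>lborel)" .
  also have "\<dots> = (\<integral>\<^sup>+y. \<integral>\<^sup>+x. F (Complex x y) \<partial>lborel \<partial>lborel)"
    by (rule lborel_pair.Fubini'[symmetric]) measurable
  finally show "(\<integral>\<^sup>+z. F z \<partial>lborel) = (\<integral>\<^sup>+y. \<integral>\<^sup>+x. F (Complex x y) \<partial>lborel \<partial>lborel)" .
qed

text \<open>With one coordinate fixed, a shear translates the other, and the inner integral is
  translation invariant.\<close>

lemma nn_integral_shear:
  fixes F :: "complex \<Rightarrow> ennreal"
  assumes [measurable]: "F \<in> borel_measurable borel"
  shows nn_integral_shear_Re: "(\<integral>\<^sup>+z. F (Complex (Re z + c * Im z) (Im z)) \<partial>lborel) = (\<integral>\<^sup>+z. F z \<partial>lborel)"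
    and nn_integral_shear_Im: "(\<integral>\<^sup>+z. F (Complex (Re z) (Im z + c * Re z)) \<partial>lborel) = (\<integral>\<^sup>+z. F z \<partial>lborel)"
proof -
  have shift: "(\<integral>\<^sup>+x. u (x + t) \<partial>lborel) = (\<integral>\<^sup>+x. u x \<partial>lborel)"
    if "u \<in> borel_measurable borel" for u :: "real \<Rightarrow> ennreal" and t
    using nn_integral_real_affine[OF that, of 1 t] by (simp add: add.commute)
  have "(\<integral>\<^sup>+z. F (Complex (Re z + c * Im z) (Im z)) \<partial>lborel)
      = (\<integral>\<^sup>+y. \<integral>\<^sup>+x. F (Complex (x + c * y) y) \<partial>lborel \<partial>lborel)"
    by (subst nn_integral_complex_iterated(2)) auto
  also have "\<dots> = (\<integral>\<^sup>+z. F z \<partial>lborel)"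
    unfolding nn_integral_complex_iterated(2)[OF assms]
    by (intro nn_integral_cong shift) measurable
  finally show "(\<integral>\<^sup>+z. F (Complex (Re z + c * Im z) (Im z)) \<partial>lborel) = (\<integral>\<^sup>+z. F z \<partial>lborel)" .
  have "(\<integral>\<^sup>+z. F (Complex (Re z) (Im z + c * Re z)) \<partial>lborel)
      = (\<integral>\<^sup>+x. \<integral>\<^sup>+y. F (Complex x (y + c * x)) \<partial>lborel \<partial>lborel)"
    by (subst nn_integral_complex_iterated(1)) auto
  also have "\<dots> = (\<integral>\<^sup>+z. F z \<partial>lborel)"
    unfolding nn_integral_complex_iterated(1)[OF assms]
    by (intro nn_integral_cong shift) measurable
  finally show "(\<integral>\<^sup>+z. F (Complex (Re z) (Im z + c * Re z)) \<partial>lborel) = (\<integral>\<^sup>+z. F z \<partial>lborel)" .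
qed

text \<open>A rotation by an angle that is not a multiple of \<open>\<pi>\<close> is a product of three shears.\<close>

lemma nn_integral_rotate:
  fixes F :: "complex \<Rightarrow> ennreal"
  assumes F [measurable]: "F \<in> borel_measurable borel" and w: "cmod w = 1"
  shows "(\<integral>\<^sup>+z. F (w * z) \<partial>lborel) = (\<integral>\<^sup>+z. F z \<partial>lborel)"
proof -
  have generic: "(\<integral>\<^sup>+z. G (w * z) \<partial>lborel) = (\<integral>\<^sup>+z. G z \<partial>lborel)"
    if w: "cmod w = 1" "Im w \<noteq> 0" and G [measurable]: "G \<in> borel_measurable borel"
    for w :: complex and G :: "complex \<Rightarrow> ennreal"
  proof -
    define c s where "c = Re w" and "s = Im w"
    \<comment> \<open>If \<open>w = cis \<phi>\<close>, then \<open>p\<close> is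
      \<open>- tan (\<phi> / 2)\<close>: the rotation is the horizontal shear by \<open>p\<close>,
      then the vertical one by \<open>s\<close>, then the horizontal one by \<open>p\<close>
      again.\<close>
    define p where "p = (c - 1) / s"
    have cs: "c\<^sup>2 + s\<^sup>2 = 1" using w(1) by (simp add: c_def s_def cmod_def)
    have s: "s \<noteq> 0" using w(2) by (simp add: s_def)
    have ps: "p * s = c - 1" using s by (simp add: p_def)
    have "p * (c + 1) = - s"
      using s cs by (simp add: p_def divide_simps) (simp add: algebra_simps power2_eq_square)
    define H where "H z = G (Complex (Re z + p * Im z) (Im z))" for z
    define K where "K z = H (Complex (Re z) (Im z + s * Re z))" for z
    have [measurable]: "H \<in> borel_measurable borel" "K \<in> borel_measurable borel"
      unfolding H_def K_def by measurable
    have "w * z = Complex ((Re z + p * Im z) + p * (Im z + s * (Re z + p * Im z)))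
        (Im z + s * (Re z + p * Im z))" for z
    proof (rule complex_eqI)
      have "(Re z + p * Im z) + p * (Im z + s * (Re z + p * Im z))
          = (1 + p * s) * Re z + p * (2 + p * s) * Im z" by (simp add: algebra_simps)
      also have "\<dots> = c * Re z - s * Im z" using \<open>p * (c + 1) = - s\<close> by (simp add: ps algebra_simps)
      finally show "Re (w * z) = Re (Complex ((Re z + p * Im z) + p * (Im z + s * (Re z + p * Im z)))
        (Im z + s * (Re z + p * Im z)))" by (simp add: c_def s_def)
      have "Im z + s * (Re z + p * Im z) = s * Re z + (1 + p * s) * Im z" by (simp add: algebra_simps)
      also have "\<dots> = s * Re z + c * Im z" by (simp add: ps)
      finally show "Im (w * z) = Im (Complex ((Re z + p * Im z) + p * (Im z + s * (Re z + p * Im z)))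
        (Im z + s * (Re z + p * Im z)))" by (simp add: c_def s_def)
    qed
    hence "G (w * z) = K (Complex (Re z + p * Im z) (Im z))" for z
      by (simp add: H_def K_def)
    hence "(\<integral>\<^sup>+z. G (w * z) \<partial>lborel) = (\<integral>\<^sup>+z. K z \<partial>lborel)"
      by (simp add: nn_integral_shear_Re)
    also have "\<dots> = (\<integral>\<^sup>+z. H z \<partial>lborel)" unfolding K_def by (rule nn_integral_shear_Im) simp
    also have "\<dots> = (\<integral>\<^sup>+z. G z \<partial>lborel)" unfolding H_def by (rule nn_integral_shear_Re) simp
    finally show ?thesis .
  qed
  show ?thesis
  proof (cases "Im w = 0")
    case False
    with w show ?thesis by (intro generic F)
  next
    case True
    \<comment> \<open>A real \<open>w\<close> is split into the non-real rotations
      \<open>\<i>\<close> and \<open>w / \<i>\<close>, to which the shear argument applies.\<close>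
    have "w * z = (w / \<i>) * (\<i> * z)" for z by (simp add: complex_eq_iff)
    hence "(\<integral>\<^sup>+z. F (w * z) \<partial>lborel) = (\<integral>\<^sup>+z. F ((w / \<i>) * (\<i> * z)) \<partial>lborel)" by simp
    also have "\<dots> = (\<integral>\<^sup>+z. F ((w / \<i>) * z) \<partial>lborel)" by (rule generic) auto
    also have "\<dots> = (\<integral>\<^sup>+z. F z \<partial>lborel)"
    proof (rule generic)
      have "Re w \<noteq> 0" using w True by (auto simp: cmod_def)
      thus "Im (w / \<i>) \<noteq> 0" by simp
    qed (use w in \<open>simp_all add: norm_divide norm_mult\<close>)
    finally show ?thesis .
  qed
qed

text \<open>Closed half-lines form an intersection-stable generator, and for
  \<open>x \<ge> 0\<close> the preimage of \<open>{..x}\<close> is a disc of radius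
  \<open>sqrt x\<close>, of area \<open>pi * x\<close>.\<close>

lemma distr_lborel_cmod_squared:
  "distr lborel borel (\<lambda>z::complex. (cmod z)\<^sup>2) = density lborel (\<lambda>t. ennreal (pi * indicator {0..} t))"
proof (rule measure_eqI_generator_eq[where E = "range atMost" and A = "\<lambda>n. {..real n}" and \<Omega> = UNIV])
  show "Int_stable (range (atMost :: real \<Rightarrow> _))"
    by (auto simp: Int_stable_def)
  have eq: "emeasure (distr lborel borel (\<lambda>z::complex. (cmod z)\<^sup>2)) {..x} = ennreal (pi * max 0 x)"
      "emeasure (density lborel (\<lambda>t. ennreal (pi * indicator {0..} t))) {..x} = ennreal (pi * max 0 x)" for x :: real
  proof -
    have vim: "(\<lambda>z::complex. (cmod z)\<^sup>2) -` {..x} = (if x < 0 then {} else cball 0 (sqrt x))"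
    proof (cases "x < 0")
      case True
      hence "\<not> (cmod z)\<^sup>2 \<le> x" for z using zero_le_power2[of "cmod z"] by linarith
      with True show ?thesis by auto
    next
      case False
      hence "(cmod z)\<^sup>2 \<le> x \<longleftrightarrow> cmod z \<le> sqrt x" for z
        by (metis abs_norm_cancel real_sqrt_abs real_sqrt_le_iff)
      with False show ?thesis by auto
    qed
    show "emeasure (distr lborel borel (\<lambda>z::complex. (cmod z)\<^sup>2)) {..x} = ennreal (pi * max 0 x)"
      by (simp add: emeasure_distr vim emeasure_cball unit_ball_vol_2 max_def)
    have "emeasure (density lborel (\<lambda>t. ennreal (pi * indicator {0..} t))) {..x}
        = (\<integral>\<^sup>+t. ennreal pi * indicator {0..x} t \<partial>lborel)"
      by (subst emeasure_density) (auto intro!: nn_integral_cong simp: indicator_def)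
    also have "\<dots> = ennreal (pi * max 0 x)"
      by (simp add: nn_integral_cmult ennreal_mult max_def)
    finally show "emeasure (density lborel (\<lambda>t. ennreal (pi * indicator {0..} t))) {..x} = ennreal (pi * max 0 x)" .
  qed
  show "emeasure (distr lborel borel (\<lambda>z::complex. (cmod z)\<^sup>2)) X
      = emeasure (density lborel (\<lambda>t. ennreal (pi * indicator {0..} t))) X"
    if "X \<in> range atMost" for X
    using that eq by auto
  show "emeasure (distr lborel borel (\<lambda>z::complex. (cmod z)\<^sup>2)) {..real n} \<noteq> \<infinity>" for n
    by (simp add: eq)
  show "(\<Union>n. {..real n}) = UNIV" using real_arch_simple by auto
  have "sets (borel :: real measure) = sigma_sets UNIV (range atMost)"
    by (subst borel_eq_atMost) simp
  thus "sets (distr lborel borel (\<lambda>z::complex. (cmod z)\<^sup>2)) = sigma_sets UNIV (range atMost)"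
    "sets (density lborel (\<lambda>t. ennreal (pi * indicator {0..} t))) = sigma_sets UNIV (range (atMost :: real \<Rightarrow> _))"
    by simp_all
qed auto

section \<open>Circular means of power series, integrated against radial weights\<close>

lemma mean_square_power_series:
  fixes f :: "complex \<Rightarrow> complex"
  assumes f: "\<And>z. (\<lambda>n. a n * z ^ n) sums f z"
  shows "(\<lambda>n. (cmod (a n))\<^sup>2 * cmod z ^ (2 * n)) sums
           ((LINT \<theta>|angle_measure. (cmod (f (cis \<theta> * z)))\<^sup>2) / (2 * pi))"
proof -
  \<comment> \<open>Multiplying the coefficients by powers of \<open>u\<close> makes the circle
    start at \<open>z\<close> itself, so that the mean runs over the rotations
    \<open>cis \<theta> * z\<close>.\<close>
  define u where "u = cis (Arg z)"
  have u: "cmod u = 1" "z = of_real (cmod z) * u"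
    unfolding u_def using rcis_cmod_Arg[of z] by (simp_all add: rcis_def)
  have "(\<lambda>n. (cmod (a n * u ^ n))\<^sup>2 * cmod z ^ (2 * n)) sums
      ((LINT \<theta>|angle_measure. (cmod (f (of_real (cmod z) * cis \<theta> * u)))\<^sup>2) / (2 * pi))"
  proof (rule circle_parseval[where F = "\<lambda>w. f (w * u)"])
    have "summable (\<lambda>n. a n * of_real (cmod z + 1) ^ n)"
      using f sums_summable by blast
    hence "summable (\<lambda>n. cmod (a n * of_real (cmod z) ^ n))"
      by (rule powser_insidea) (simp only: norm_of_real, simp)
    thus "summable (\<lambda>n. cmod (a n * u ^ n) * cmod z ^ n)"
      by (simp add: norm_mult norm_power u(1))
    show "(\<lambda>n. a n * u ^ n * w ^ n) sums f (w * u)" for w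
      using f[of "w * u"] by (simp add: power_mult_distrib mult_ac)
  qed simp
  moreover have "of_real (cmod z) * cis \<theta> * u = cis \<theta> * z" for \<theta>
    using arg_cong[OF u(2), of "\<lambda>v. cis \<theta> * v"] by (simp only: mult_ac)
  ultimately show ?thesis by (simp add: norm_mult norm_power u(1))
qed

text \<open>After Fubini the integral over the plane is the same for every angle, since area and
  \<open>cmod z\<close> are rotation invariant; the angles contribute the factor
  \<open>2 * pi\<close>.\<close>

lemma nn_integral_circle_average:
  fixes F :: "complex \<Rightarrow> ennreal" and V :: "real \<Rightarrow> ennreal"
  assumes [measurable]: "F \<in> borel_measurable borel" "V \<in> borel_measurable borel"
  shows "(\<integral>\<^sup>+z. (\<integral>\<^sup>+\<theta>. F (cis \<theta> * z) \<partial>angle_measure) * V (cmod z) \<partial>lborel)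
       = ennreal (2 * pi) * (\<integral>\<^sup>+z. F z * V (cmod z) \<partial>lborel)"
proof -
  interpret angle: finite_measure angle_measure by (rule finite_measure_angle)
  interpret pair_sigma_finite angle_measure "lborel :: complex measure" ..
  have id [measurable]: "(\<lambda>\<theta>. \<theta>) \<in> angle_measure \<rightarrow>\<^sub>M borel"
    by (intro measurable_restrict_space1) simp
  have cis [measurable]: "cis \<in> borel \<rightarrow>\<^sub>M borel"
    by (intro borel_measurable_continuous_onI continuous_intros)
  have [measurable]: "(\<lambda>(\<theta>, z). F (cis \<theta> * z)) \<in> borel_measurable (angle_measure \<Otimes>\<^sub>M lborel)"
    by measurable
  have "(\<integral>\<^sup>+z. (\<integral>\<^sup>+\<theta>. F (cis \<theta> * z) \<partial>angle_measure) * V (cmod z) \<partial>lborel)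
      = (\<integral>\<^sup>+z. (\<integral>\<^sup>+\<theta>. F (cis \<theta> * z) * V (cmod z) \<partial>angle_measure) \<partial>lborel)"
    by (intro nn_integral_cong nn_integral_multc[symmetric]) measurable
  also have "\<dots> = (\<integral>\<^sup>+\<theta>. (\<integral>\<^sup>+z. F (cis \<theta> * z) * V (cmod z) \<partial>lborel) \<partial>angle_measure)"
    by (rule Fubini') measurable
  also have "\<dots> = (\<integral>\<^sup>+\<theta>. (\<integral>\<^sup>+z. F z * V (cmod z) \<partial>lborel) \<partial>angle_measure)"
  proof (rule nn_integral_cong)
    have FV: "(\<lambda>z. F z * V (cmod z)) \<in> borel_measurable borel" by measurable
    fix \<theta>
    have "(\<integral>\<^sup>+z. F (cis \<theta> * z) * V (cmod z) \<partial>lborel)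
        = (\<integral>\<^sup>+z. F (cis \<theta> * z) * V (cmod (cis \<theta> * z)) \<partial>lborel)" by (simp add: norm_mult)
    also have "\<dots> = (\<integral>\<^sup>+z. F z * V (cmod z) \<partial>lborel)"
      using nn_integral_rotate[OF FV norm_cis] by simp
    finally show "(\<integral>\<^sup>+z. F (cis \<theta> * z) * V (cmod z) \<partial>lborel) = (\<integral>\<^sup>+z. F z * V (cmod z) \<partial>lborel)" .
  qed
  also have "\<dots> = ennreal (2 * pi) * (\<integral>\<^sup>+z. F z * V (cmod z) \<partial>lborel)"
    by (simp add: emeasure_restrict_space space_restrict_space mult.commute)
  finally show ?thesis .
qed

text \<open>Averaging over circles does not change an integral against a radial weight, and by
  Parseval the average of the squared modulus is the power series. Working with nonnegative
  integrals yields integrability as well.\<close>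

lemma radial_integral_power_series:
  fixes f :: "complex \<Rightarrow> complex" and V :: "real \<Rightarrow> real"
  assumes f: "\<And>z. (\<lambda>n. a n * z ^ n) sums f z" and cont: "continuous_on UNIV f"
    and V [measurable]: "V \<in> borel_measurable borel" and V0: "\<And>r. 0 \<le> V r"
    and int: "integrable lborel (\<lambda>z. (cmod (f z))\<^sup>2 * V (cmod z))"
  shows "has_bochner_integral lborel (\<lambda>z. (\<Sum>n. (cmod (a n))\<^sup>2 * cmod z ^ (2 * n)) * V (cmod z))
           (LINT z|lborel. (cmod (f z))\<^sup>2 * V (cmod z))"
proof (rule has_bochner_integral_nn_integral)
  define A where "A z = (\<Sum>n. (cmod (a n))\<^sup>2 * cmod z ^ (2 * n))" for z
  have A0: "0 \<le> A z" for z unfolding A_def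
    using mean_square_power_series[OF f, of z] by (intro suminf_nonneg) (auto simp: sums_iff)
  have fm [measurable]: "f \<in> borel_measurable borel"
    using cont by (rule borel_measurable_continuous_onI)
  have avg: "(\<integral>\<^sup>+\<theta>. ennreal ((cmod (f (cis \<theta> * z)))\<^sup>2) \<partial>angle_measure) = ennreal (2 * pi) * ennreal (A z)" for z
  proof -
    have "continuous_on {0..2*pi} (\<lambda>\<theta>. (cmod (f (cis \<theta> * z)))\<^sup>2)"
      by (intro continuous_intros continuous_on_compose2[OF cont]) auto
    hence "set_integrable lborel {0..2*pi} (\<lambda>\<theta>. (cmod (f (cis \<theta> * z)))\<^sup>2)"
      by (rule borel_integrable_atLeastAtMost')
    hence "integrable angle_measure (\<lambda>\<theta>. (cmod (f (cis \<theta> * z)))\<^sup>2)"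
      by (simp add: integrable_restrict_space set_integrable_def)
    hence "(\<integral>\<^sup>+\<theta>. ennreal ((cmod (f (cis \<theta> * z)))\<^sup>2) \<partial>angle_measure)
        = ennreal (LINT \<theta>|angle_measure. (cmod (f (cis \<theta> * z)))\<^sup>2)"
      by (rule nn_integral_eq_integral) simp
    also have "(LINT \<theta>|angle_measure. (cmod (f (cis \<theta> * z)))\<^sup>2) = 2 * pi * A z"
      using mean_square_power_series[OF f, of z] by (simp add: A_def sums_iff)
    finally show ?thesis by (simp add: ennreal_mult A0)
  qed
  have [measurable]: "A \<in> borel_measurable borel" unfolding A_def by measurable
  have "ennreal (2 * pi) * (\<integral>\<^sup>+z. ennreal (A z) * ennreal (V (cmod z)) \<partial>lborel)
      = (\<integral>\<^sup>+z. (\<integral>\<^sup>+\<theta>. ennreal ((cmod (f (cis \<theta> * z)))\<^sup>2) \<partial>angle_measure) * ennreal (V (cmod z)) \<partial>lborel)"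
    by (subst nn_integral_cmult[symmetric]) (simp_all add: avg mult.assoc)
  also have "\<dots> = ennreal (2 * pi) * (\<integral>\<^sup>+z. ennreal ((cmod (f z))\<^sup>2) * ennreal (V (cmod z)) \<partial>lborel)"
    by (rule nn_integral_circle_average) measurable
  finally have "(\<integral>\<^sup>+z. ennreal (A z) * ennreal (V (cmod z)) \<partial>lborel)
      = (\<integral>\<^sup>+z. ennreal ((cmod (f z))\<^sup>2) * ennreal (V (cmod z)) \<partial>lborel)"
    by (simp add: ennreal_mult_cancel_left ennreal_mult_eq_top_iff)
  also have "\<dots> = (\<integral>\<^sup>+z. ennreal ((cmod (f z))\<^sup>2 * V (cmod z)) \<partial>lborel)"
    by (simp add: ennreal_mult V0)
  also have "\<dots> = ennreal (LINT z|lborel. (cmod (f z))\<^sup>2 * V (cmod z))"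
    by (rule nn_integral_eq_integral[OF int]) (simp add: V0)
  finally show "(\<integral>\<^sup>+z. ennreal (A z * V (cmod z)) \<partial>lborel) = \<dots>"
    by (simp add: ennreal_mult A0 V0)
  show "(\<lambda>z. A z * V (cmod z)) \<in> borel_measurable lborel" by measurable
  show "AE z in lborel. 0 \<le> A z * V (cmod z)" by (simp add: A0 V0)
qed (auto intro!: Bochner_Integration.integral_nonneg simp: V0)

section \<open>Transfer from the half-line to the plane, and Borel representatives of the
  weight\<close>

lemma has_bochner_integral_cmod_squared:
  fixes h :: "real \<Rightarrow> real"
  assumes hx: "has_bochner_integral lborel h x" and neg: "\<And>t. t < 0 \<Longrightarrow> h t = 0"
  shows "has_bochner_integral lborel (\<lambda>z::complex. h ((cmod z)\<^sup>2)) (pi * x)"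
proof -
  have int: "integrable lborel h" and x: "x = (LINT t|lborel. h t)"
    using hx by (auto simp: has_bochner_integral_iff)
  have [measurable]: "h \<in> borel_measurable borel" using int by auto
  \<comment> \<open>Vanishing on the negative axis lets the indicator in the image density be
    dropped.\<close>
  have h: "pi * indicat_real {0..} t * h t = pi * h t" for t
    using neg[of t] by (cases "t < 0") (auto simp: indicator_def)
  have "integrable (density lborel (\<lambda>t. ennreal (pi * indicator {0..} t))) h"
    by (subst integrable_density) (use int in \<open>auto simp: h\<close>)
  hence "integrable lborel (\<lambda>z::complex. h ((cmod z)\<^sup>2))"
    unfolding distr_lborel_cmod_squared[symmetric] by (rule integrable_distr[rotated]) simp
  moreover have "(LINT z|lborel. h ((cmod z)\<^sup>2)) = (LINT t|distr lborel borel (\<lambda>z::complex. (cmod z)\<^sup>2). h t)"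
    by (rule integral_distr[symmetric]) auto
  hence "(LINT z::complex|lborel. h ((cmod z)\<^sup>2)) = pi * (LINT t|lborel. h t)"
    unfolding distr_lborel_cmod_squared by (subst (asm) integral_density) (auto simp: h)
  ultimately show ?thesis by (simp add: has_bochner_integral_iff x)
qed

text \<open>Since \<open>W\<close> is only Lebesgue measurable, it is replaced by a Borel function
  before composing with the squared modulus. Equality almost everywhere on the line pulls back to
  the plane because the image of area has a density.\<close>

lemma radial_weight_borel_representative:
  assumes "radial_weight W"
  obtains V :: "real \<Rightarrow> real" where "V \<in> borel_measurable borel" "\<And>t. 0 \<le> V t" "\<And>t. t < 0 \<Longrightarrow> V t = 0"
    "AE z in lborel. W ((cmod (z::complex))\<^sup>2) = V ((cmod z)\<^sup>2)"
    "\<And>k. has_bochner_integral lborel (\<lambda>t. t ^ k * V t) (radial_moment W k)"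
    "\<not> (AE t in lborel. V t = 0)"
proof -
  note W = assms[unfolded radial_weight_def]
  define U where "U t = (if t \<in> {0..} then W t else 0)" for t
  have U: "U \<in> borel_measurable lebesgue"
    using W unfolding U_def by (subst borel_measurable_if) auto
  then obtain W0 where W0 [measurable]: "W0 \<in> borel_measurable lborel" and ae: "AE t in lborel. U t = W0 t"
    using completion_ex_borel_measurable_real by blast
  \<comment> \<open>The truncation makes sign and support hold everywhere; equality with
    \<open>U\<close> almost everywhere survives, as \<open>U\<close> already has both
    properties.\<close>
  define V where "V t = indicator {0..} t * max 0 (W0 t)" for t
  have V [measurable]: "V \<in> borel_measurable borel" using W0 unfolding V_def by measurable
  have UV: "AE t in lborel. U t = V t"
    using ae by eventually_elim (use W in \<open>auto simp: U_def V_def indicator_def split: if_splits\<close>)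
  hence UV': "AE t in lebesgue. U t = V t" by (rule AE_completion)
  have "AE t in density lborel (\<lambda>t. ennreal (pi * indicator {0..} t)). U t = V t"
    by (subst AE_density) (use UV in auto)
  hence "AE t in distr lborel borel (\<lambda>z::complex. (cmod z)\<^sup>2). U t = V t"
    unfolding distr_lborel_cmod_squared .
  hence "AE z in lborel. U ((cmod (z::complex))\<^sup>2) = V ((cmod z)\<^sup>2)"
    by (rule AE_distrD[rotated]) simp
  hence 1: "AE z in lborel. W ((cmod (z::complex))\<^sup>2) = V ((cmod z)\<^sup>2)"
    by (simp add: U_def)
  have 2: "has_bochner_integral lborel (\<lambda>t. t ^ k * V t) (radial_moment W k)" for k
  proof -
    have eq: "indicat_real {0..} t * (t ^ k * W t) = t ^ k * U t" for t
      by (simp add: U_def indicator_def)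
    have "integrable (lebesgue_on {0..}) (\<lambda>t. t ^ k * W t)" using W by blast
    hence "integrable lebesgue (\<lambda>t. t ^ k * U t)"
      by (simp add: integrable_restrict_space eq)
    moreover have "radial_moment W k = (LINT t|lebesgue. t ^ k * U t)"
      unfolding radial_moment_def by (subst integral_restrict_space) (auto simp: eq)
    ultimately have "has_bochner_integral lebesgue (\<lambda>t. t ^ k * U t) (radial_moment W k)"
      by (simp add: has_bochner_integral_iff)
    also have "?this \<longleftrightarrow> has_bochner_integral lebesgue (\<lambda>t. t ^ k * V t) (radial_moment W k)"
    proof (rule has_bochner_integral_cong_AE)
      have [measurable]: "(\<lambda>t::real. t ^ k) \<in> borel_measurable lebesgue" "V \<in> borel_measurable lebesgue"
        by (auto intro!: measurable_completion)
      note U [measurable]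
      show "(\<lambda>t. t ^ k * U t) \<in> borel_measurable lebesgue" "(\<lambda>t. t ^ k * V t) \<in> borel_measurable lebesgue"
        by measurable
      show "AE t in lebesgue. t ^ k * U t = t ^ k * V t" using UV' by eventually_elim simp
    qed
    finally show ?thesis
      by (simp add: has_bochner_integral_iff integrable_completion integral_completion)
  qed
  have 3: "\<not> (AE t in lborel. V t = 0)"
  proof
    assume "AE t in lborel. V t = 0"
    hence "AE t in lebesgue. V t = 0" by (rule AE_completion)
    with UV' have "AE t in lebesgue. t \<in> {0..} \<longrightarrow> W t = 0"
      by eventually_elim (auto simp: U_def)
    hence "AE t in lebesgue_on {0..}. W t = 0" by (simp add: AE_restrict_space_iff)
    with W show False by blast
  qed
  show ?thesis by (rule that[OF V _ _ 1 2 3]) (auto simp: V_def)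
qed

text \<open>A vanishing moment would make \<open>t ^ k * V t\<close>, hence \<open>V\<close> off the
  null set consisting of 0, vanish almost everywhere.\<close>

lemma moment_pos:
  fixes V :: "real \<Rightarrow> real"
  assumes V: "\<And>t. 0 \<le> V t" "\<And>t. t < 0 \<Longrightarrow> V t = 0" "\<not> (AE t in lborel. V t = 0)"
    and int: "has_bochner_integral lborel (\<lambda>t. t ^ k * V t) m"
  shows "m > 0"
proof -
  have nn: "0 \<le> t ^ k * V t" for t using V(1,2)[of t] by (cases "t < 0") auto
  have m: "integrable lborel (\<lambda>t. t ^ k * V t)" "m = (LINT t|lborel. t ^ k * V t)"
    using int by (auto simp: has_bochner_integral_iff)
  have "m \<noteq> 0"
  proof
    assume "m = 0"
    hence "AE t in lborel. t ^ k * V t = 0"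
      using m integral_nonneg_eq_0_iff_AE[OF m(1)] nn by auto
    moreover have "AE t in lborel. t \<noteq> (0::real)" by (rule AE_lborel_singleton)
    ultimately have "AE t in lborel. V t = 0" by eventually_elim auto
    with V(3) show False by blast
  qed
  moreover have "0 \<le> m" unfolding m(2) by (intro Bochner_Integration.integral_nonneg nn)
  ultimately show ?thesis by simp
qed

lemma taylor_series_entire:
  assumes "f holomorphic_on UNIV"
  shows "(\<lambda>n. (deriv ^^ n) f 0 / fact n * z ^ n) sums f z"
  using holomorphic_power_series[of f 0 "cmod z + 1" z] assms
  by (auto intro: holomorphic_on_subset)

section \<open>The norm inequality\<close>

theorem mainTheorem7:
  fixes W :: "real \<Rightarrow> real" and f g :: "complex \<Rightarrow> complex" and \<rho> :: real
  assumes "radial_weight W"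
    and "\<rho> = sqrt (radial_moment W 1 / radial_moment W 0)"
    and "f \<in> weighted_Fock_space W" and "g \<in> weighted_Fock_space W"
    and "\<forall>z::complex. cmod z > \<rho> \<longrightarrow> cmod (f z) \<le> cmod (g z)"
    and "\<forall>z::complex. cmod z = \<rho> \<longrightarrow> cmod (f z) = cmod (g z)"
  shows "weighted_Fock_norm W f \<le> weighted_Fock_norm W g"
proof -
  obtain V :: "real \<Rightarrow> real" where V [measurable]: "V \<in> borel_measurable borel"
    and V0: "\<And>t. 0 \<le> V t" "\<And>t. t < 0 \<Longrightarrow> V t = 0"
    and WV: "AE z in lborel. W ((cmod (z::complex))\<^sup>2) = V ((cmod z)\<^sup>2)"
    and moment: "\<And>k. has_bochner_integral lborel (\<lambda>t. t ^ k * V t) (radial_moment W k)"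
    and Vnz: "\<not> (AE t in lborel. V t = 0)"
    using radial_weight_borel_representative[OF assms(1)] by blast
  define m where "m = radial_moment W"
  have mpos: "m k > 0" for k
    unfolding m_def by (rule moment_pos[OF V0 Vnz moment])
  have \<rho>2: "\<rho>\<^sup>2 = m 1 / m 0" and \<rho>: "\<rho> > 0"
    using assms(2) mpos[of 0] mpos[of 1] by (auto simp: m_def)
  have hol: "f holomorphic_on UNIV" "g holomorphic_on UNIV"
    using assms(3,4) by (auto simp: weighted_Fock_space_def)

  \<comment> \<open>From here on \<open>V\<close> and \<open>lborel\<close> replace \<open>W\<close>
    and \<open>lebesgue\<close>; the integrands agree almost everywhere.\<close>
  have norm_eq: "integrable lborel (\<lambda>z. (cmod (u z))\<^sup>2 * V ((cmod z)\<^sup>2)) \<and>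
      weighted_Fock_norm W u = sqrt (1 / pi * (LINT z|lborel. (cmod (u z))\<^sup>2 * V ((cmod z)\<^sup>2)))"
    if u: "u \<in> weighted_Fock_space W" for u
  proof -
    have "continuous_on UNIV u"
      using u holomorphic_on_imp_continuous_on by (auto simp: weighted_Fock_space_def)
    hence [measurable]: "u \<in> borel_measurable borel" by (rule borel_measurable_continuous_onI)
    have meas: "(\<lambda>z. (cmod (u z))\<^sup>2 * V ((cmod z)\<^sup>2)) \<in> borel_measurable lborel" by measurable
    have int: "integrable lebesgue (\<lambda>z. (cmod (u z))\<^sup>2 * W ((cmod z)\<^sup>2))"
      using u by (simp add: weighted_Fock_space_def)
    have ae: "AE z in lebesgue. (cmod (u z))\<^sup>2 * W ((cmod z)\<^sup>2) = (cmod (u z))\<^sup>2 * V ((cmod z)\<^sup>2)"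
      using AE_completion[OF WV] by eventually_elim simp
    note cong = borel_measurable_integrable[OF int] measurable_completion[OF meas] ae
    show ?thesis
      unfolding weighted_Fock_norm_def integral_cong_AE[OF cong]
      using int meas unfolding integrable_cong_AE[OF cong]
      by (simp add: integrable_completion integral_completion)
  qed
  have int_fg: "integrable lborel (\<lambda>z. (cmod (f z))\<^sup>2 * V ((cmod z)\<^sup>2))"
    "integrable lborel (\<lambda>z. (cmod (g z))\<^sup>2 * V ((cmod z)\<^sup>2))"
    using norm_eq assms(3,4) by blast+

  have "(LINT z|lborel. (cmod (f z))\<^sup>2 * V ((cmod z)\<^sup>2)) \<le> (LINT z|lborel. (cmod (g z))\<^sup>2 * V ((cmod z)\<^sup>2))"
  \<comment> \<open>The reflection argument needs a point where \<open>f\<close> does not vanish;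
    for \<open>f = 0\<close> the left side is 0.\<close>
  proof (cases "\<exists>w. f w \<noteq> 0")
    case False
    thus ?thesis by (auto intro!: Bochner_Integration.integral_nonneg simp: V0)
  next
    case True
    then obtain w0 where w0: "f w0 \<noteq> 0" by blast
    define a b where "a n = (deriv ^^ n) f 0 / fact n" and "b n = (deriv ^^ n) g 0 / fact n" for n
    have series: "\<And>z. (\<lambda>n. a n * z ^ n) sums f z" "\<And>z. (\<lambda>n. b n * z ^ n) sums g z"
      unfolding a_def b_def by (rule taylor_series_entire; rule hol)+
    define A B where "A z = (\<Sum>n. (cmod (a n))\<^sup>2 * cmod z ^ (2 * n))"
      and "B z = (\<Sum>n. (cmod (b n))\<^sup>2 * cmod z ^ (2 * n))" for z :: complex
    note mean = mean_square_power_series[OF series(1)] mean_square_power_series[OF series(2)]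
    have AB: "(\<lambda>n. (cmod (a n))\<^sup>2 * cmod z ^ (2 * n)) sums A z"
      "(\<lambda>n. (cmod (b n))\<^sup>2 * cmod z ^ (2 * n)) sums B z" for z
      unfolding A_def B_def using mean[of z] by (auto intro!: summable_sums simp: sums_iff)
    have ABint: "has_bochner_integral lborel (\<lambda>z. A z * V ((cmod z)\<^sup>2)) (LINT z|lborel. (cmod (f z))\<^sup>2 * V ((cmod z)\<^sup>2))"
      "has_bochner_integral lborel (\<lambda>z. B z * V ((cmod z)\<^sup>2)) (LINT z|lborel. (cmod (g z))\<^sup>2 * V ((cmod z)\<^sup>2))"
    proof -
      have [measurable]: "(\<lambda>r. V (r\<^sup>2)) \<in> borel_measurable borel" by measurable
      note radial = radial_integral_power_series[where V = "\<lambda>r. V (r\<^sup>2)", OF _ _ this V0(1)]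
      show "has_bochner_integral lborel (\<lambda>z. A z * V ((cmod z)\<^sup>2)) (LINT z|lborel. (cmod (f z))\<^sup>2 * V ((cmod z)\<^sup>2))"
        unfolding A_def
        by (rule radial[OF series(1) holomorphic_on_imp_continuous_on[OF hol(1)] int_fg(1)])
      show "has_bochner_integral lborel (\<lambda>z. B z * V ((cmod z)\<^sup>2)) (LINT z|lborel. (cmod (g z))\<^sup>2 * V ((cmod z)\<^sup>2))"
        unfolding B_def
        by (rule radial[OF series(2) holomorphic_on_imp_continuous_on[OF hol(2)] int_fg(2)])
    qed

    \<comment> \<open>The powers of \<open>\<rho>\<close> move the critical circle to
      \<open>t = 1\<close> in the variable \<open>t = (cmod z / \<rho>)^2\<close>.\<close>
    define d where "d k = ((cmod (b k))\<^sup>2 - (cmod (a k))\<^sup>2) * \<rho> ^ (2 * k)" for k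
    have dle: "(\<Sum>k\<le>n. d k) \<le> 0" for n
    proof -
      \<comment> \<open>By the identity theorem \<open>f\<close> cannot vanish on the whole disc;
        this supplies the witness for the coefficient comparison.\<close>
      have "\<exists>w. cmod w < \<rho> \<and> f w \<noteq> 0"
      proof (rule ccontr)
        assume "\<not> ?thesis"
        hence "f w0 = 0"
          using analytic_continuation_open[of "ball 0 \<rho>" UNIV f "\<lambda>_. 0" w0] \<rho> hol(1) connected_UNIV by simp
        with w0 show False by simp
      qed
      then obtain w1 where w1: "cmod w1 < \<rho>" "f w1 \<noteq> 0" by blast
      have "cmod (g z) \<le> cmod (f z)" if "cmod z < \<rho>" for z
        by (rule norm_le_inside_of_norm_le_outside[OF hol \<rho> _ _ w0 that]) (use assms(5,6) in auto)
      with coeff_partial_sums_le[of f \<rho> g w1 n] hol \<rho> w1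
      show ?thesis
        by (simp add: d_def a_def b_def left_diff_distrib sum_subtractf holomorphic_on_subset[of _ UNIV])
    qed
    have dsums: "(\<lambda>k. d k * (cmod z / \<rho>) ^ (2 * k)) sums (B z - A z)" for z
    proof -
      have "d k * (cmod z / \<rho>) ^ (2 * k) = ((cmod (b k))\<^sup>2 - (cmod (a k))\<^sup>2) * cmod z ^ (2 * k)" for k
        using \<rho> by (simp add: d_def power_divide)
      thus ?thesis using sums_diff[OF AB(2)[of z] AB(1)[of z]] by (simp add: left_diff_distrib)
    qed
    \<comment> \<open>Equal moduli on the circle give equal mean squares there, which is the
      zero-sum condition on \<open>d\<close>.\<close>
    have "A (of_real \<rho>) = B (of_real \<rho>)"
      using mean[of "of_real \<rho>"] assms(6) \<rho> by (simp add: A_def B_def sums_iff norm_mult)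
    with dsums[of "of_real \<rho>"] \<rho> have d0: "d sums 0" by simp
    have dabs: "summable (\<lambda>k. \<bar>d k\<bar> * R ^ k)" if R: "R \<ge> 0" for R
    proof (rule summable_comparison_test')
      \<comment> \<open>At this radius the mean-square series of \<open>f\<close> and
        \<open>g\<close> have exactly the factors \<open>\<rho> ^ (2 * k) * R ^ k\<close>.\<close>
      define z where "z = complex_of_real (\<rho> * sqrt R)"
      have z: "cmod z ^ (2 * k) = \<rho> ^ (2 * k) * R ^ k" for k
        using R \<rho> by (simp add: z_def power_mult norm_mult power_mult_distrib)
      show "summable (\<lambda>n. (cmod (b n))\<^sup>2 * cmod z ^ (2 * n) + (cmod (a n))\<^sup>2 * cmod z ^ (2 * n))"
        using AB by (intro summable_add) (auto simp: sums_iff)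
      fix k :: nat
      have "\<bar>(cmod (b k))\<^sup>2 - (cmod (a k))\<^sup>2\<bar> * (\<rho> ^ (2 * k) * R ^ k)
          \<le> ((cmod (b k))\<^sup>2 + (cmod (a k))\<^sup>2) * (\<rho> ^ (2 * k) * R ^ k)"
        using R \<rho> by (intro mult_right_mono) (auto simp: abs_le_iff)
      moreover have "\<bar>d k\<bar> = \<bar>(cmod (b k))\<^sup>2 - (cmod (a k))\<^sup>2\<bar> * \<rho> ^ (2 * k)"
        using \<rho> by (simp add: d_def abs_mult)
      ultimately show "norm (\<bar>d k\<bar> * R ^ k) \<le> (cmod (b k))\<^sup>2 * cmod z ^ (2 * k) + (cmod (a k))\<^sup>2 * cmod z ^ (2 * k)"
        using R unfolding z by (simp add: distrib_right mult.assoc)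
    qed
    \<comment> \<open>The slope at \<open>t = 1\<close> of the power series in \<open>t\<close> with
      coefficients \<open>d\<close>.\<close>
    define c where "c = (\<Sum>k. real k * d k)"
    have ptwise: "c * ((cmod z)\<^sup>2 / \<rho>\<^sup>2 - 1) \<le> B z - A z" for z
    proof -
      have "c * ((cmod z / \<rho>)\<^sup>2 - 1) \<le> (\<Sum>k. d k * ((cmod z / \<rho>)\<^sup>2) ^ k)"
        unfolding c_def by (rule suminf_power_ge_tangent[OF dle d0 dabs]) simp_all
      also have "\<dots> = B z - A z"
        using sums_unique[OF dsums[of z]] by (simp only: power_mult)
      finally show ?thesis by (simp add: power_divide)
    qed

    \<comment> \<open>Here the value of \<open>\<rho>\<close> enters: the tangent is
      \<open>c\<close> times \<open>t / \<rho>^2 - 1\<close>, and its weighted integral vanishes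
      because \<open>\<rho>^2 = m 1 / m 0\<close>.\<close>
    have "has_bochner_integral lborel (\<lambda>t. (t / \<rho>\<^sup>2 - 1) * V t) (m 1 / \<rho>\<^sup>2 - m 0)"
      using has_bochner_integral_diff[OF
          has_bochner_integral_divide_zero[OF moment[of 1], of "\<rho>\<^sup>2"] moment[of 0]]
      by (simp add: m_def left_diff_distrib)
    hence "has_bochner_integral lborel (\<lambda>t. c * ((t / \<rho>\<^sup>2 - 1) * V t)) (c * (m 1 / \<rho>\<^sup>2 - m 0))"
      by (rule has_bochner_integral_mult_right)
    moreover have "m 1 / \<rho>\<^sup>2 - m 0 = 0" using mpos[of 0] mpos[of 1] by (simp add: \<rho>2)
    ultimately have "has_bochner_integral lborel (\<lambda>t. c * ((t / \<rho>\<^sup>2 - 1) * V t)) 0" by simp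
    hence "has_bochner_integral lborel (\<lambda>z::complex. c * (((cmod z)\<^sup>2 / \<rho>\<^sup>2 - 1) * V ((cmod z)\<^sup>2))) (pi * 0)"
      by (rule has_bochner_integral_cmod_squared) (simp add: V0(2))
    hence low: "integrable lborel (\<lambda>z::complex. c * (((cmod z)\<^sup>2 / \<rho>\<^sup>2 - 1) * V ((cmod z)\<^sup>2)))"
      "(LINT z::complex|lborel. c * (((cmod z)\<^sup>2 / \<rho>\<^sup>2 - 1) * V ((cmod z)\<^sup>2))) = 0"
      unfolding has_bochner_integral_iff by simp_all
    note diff = has_bochner_integral_diff[OF ABint(2,1), unfolded has_bochner_integral_iff]
    have "(LINT z|lborel. c * (((cmod z)\<^sup>2 / \<rho>\<^sup>2 - 1) * V ((cmod z)\<^sup>2)))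
        \<le> (LINT z|lborel. B z * V ((cmod z)\<^sup>2) - A z * V ((cmod z)\<^sup>2))"
    proof (rule integral_mono[OF low(1) conjunct1[OF diff]])
      fix z :: complex
      show "c * (((cmod z)\<^sup>2 / \<rho>\<^sup>2 - 1) * V ((cmod z)\<^sup>2)) \<le> B z * V ((cmod z)\<^sup>2) - A z * V ((cmod z)\<^sup>2)"
        using mult_right_mono[OF ptwise[of z] V0(1)[of "(cmod z)\<^sup>2"]] by (simp add: algebra_simps)
    qed
    hence "0 \<le> (LINT z|lborel. (cmod (g z))\<^sup>2 * V ((cmod z)\<^sup>2)) - (LINT z|lborel. (cmod (f z))\<^sup>2 * V ((cmod z)\<^sup>2))"
      using low(2) conjunct2[OF diff] by argo
    thus ?thesis by simp
  qed
  thus ?thesis using norm_eq[OF assms(3)] norm_eq[OF assms(4)]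
    by (simp add: divide_right_mono)
qed

end
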